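(* Let $n\ge 2$ be an integer. The set $\mathcal M(n)$ of odd integers $m$ with $1\le m<n$ and $\gcd(m,n)=1$, equipped with the multiplication Modd $n$, $(m,m')\mapsto a_n(m\,m')$, is a group, and this group is isomorphic to the Galois group $\mathrm{Gal}(\mathbb Q(\rho(n))/\mathbb Q)$, where $\rho(n)=2\cos(\pi/n)$.
   Context: For $n\in\mathbb N$ and $k\in\mathbb Z$ let $r_n(k)\in\{0,1,\dots,n-1\}$ be the remainder of $k$ on division by $n$, and let $p_n(k)=(-1)^{\lfloor k/n\rfloor}$. Define $a_n(k)=r_n(k)$ if $p_n(k)=+1$ and $a_n(k)=r_n(-k)$ if $p_n(k)=-1$. *)

theory Defs
  imports
    "HOL-Analysis.Analysis"
    "HOL-Algebra.Bij"
    "HOL-Algebra.Generated_Fields"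
    "HOL-Algebra.Algebraic_Closure_Type"
begin

definition modd_rem :: "nat \<Rightarrow> int \<Rightarrow> int" where
  "modd_rem n k = k mod int n"

text \<open>Real values, because \<open>powi\<close> (the quotient may be negative) needs a division ring.\<close>

definition modd_sign :: "nat \<Rightarrow> int \<Rightarrow> real" where
  "modd_sign n k = (-1) powi \<lfloor>real_of_int k / real n\<rfloor>"

definition modd :: "nat \<Rightarrow> int \<Rightarrow> int" where
  "modd n k = (if modd_sign n k = 1 then modd_rem n k else modd_rem n (- k))"

definition modd_units :: "nat \<Rightarrow> int set" where
  "modd_units n = {m. odd m \<and> 1 \<le> m \<and> m < int n \<and> gcd m (int n) = 1}"

definition modd_monoid :: "nat \<Rightarrow> int monoid" where
  "modd_monoid n = \<lparr>carrier = modd_units n, mult = (\<lambda>m m'. modd n (m * m')), one = 1\<rparr>"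

text \<open>
  \<open>K\<close> is the base field, a subset of \<open>carrier L\<close>. As in \<^const>\<open>BijGroup\<close>, automorphisms are
  \<open>undefined\<close> outside \<open>carrier L\<close>, so that distinct elements of the group are distinct
  as maps on \<open>carrier L\<close>; the product is composition.
\<close>

definition galois_group :: "('a, 'b) ring_scheme \<Rightarrow> 'a set \<Rightarrow> ('a \<Rightarrow> 'a) monoid" where
  "galois_group L K = (BijGroup (carrier L))
     \<lparr>carrier := {\<sigma> \<in> Bij (carrier L). \<sigma> \<in> ring_iso L L \<and> (\<forall>x\<in>K. \<sigma> x = x)}\<rparr>"

definition rat_adjoin :: "real \<Rightarrow> real ring" where
  "rat_adjoin x = (ring_of_type_algebra :: real ring)
     \<lparr>carrier := generate_field ring_of_type_algebra (insert x \<rat>)\<rparr>"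

definition rho :: "nat \<Rightarrow> real" where
  "rho n = 2 * cos (pi / real n)"

end

(*
  Modd n picks from each class {k, -k} of units modulo 2n its representative in (0, n), so the
  Modd group is (Z/2n)^* / {1, -1}. The automorphism belonging to m sends rho(n) = 2 cos(pi/n)
  to 2 cos(m pi/n).

  These numbers are conjugate because of an argument of Landau that replaces the factorisation of
  cyclotomic polynomials modulo p. Let z = exp(2 pi i/N) and x_k = z^k + z^-k. For an integer
  polynomial f and a prime p we have f(x_jp) = f(x_j)^p modulo p Z[z]. A nonzero element of Z[z]
  is divisible by only finitely many primes, and f takes only N values on the x_k, so
  f(x_j) = 0 implies f(x_jp) = 0 for all large p. Every residue class coprime to N contains a
  product of large primes.

  Conversely, an automorphism s preserves the relations D_k(rho(n)) = 2, where D_k is the Dickson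
  polynomial with D_k(2 cos t) = 2 cos kt: k = 2n shows that s(rho(n)) = 2 cos(m pi/n) for
  some m, and the failure of the relation for proper divisors k of 2n shows that m is a unit
  modulo 2n.
*)

theory Submission
  imports Defs "HOL-Number_Theory.Residues"
begin

(* HOL-Algebra has homonyms of the constants for polynomials. *)
hide_const (open) Module.smult UnivPoly.coeff UnivPoly.monom Polynomials.degree Polynomials.lead_coeff

subsection \<open>Evaluation of integer polynomials\<close>

text \<open>Integer coefficients make \<open>f\<close> independent of the ring, so one
  \<open>f\<close> can be evaluated both at real cosines and at complex numbers.\<close>

definition ipoly :: "int poly \<Rightarrow> 'a::comm_ring_1 \<Rightarrow> 'a" where
  "ipoly f x = poly (map_poly of_int f) x"

lemma ipoly_0 [simp]: "ipoly 0 x = 0"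
  by (simp add: ipoly_def)

lemma ipoly_pCons [simp]: "ipoly (pCons c f) x = of_int c + x * ipoly f x"
  by (simp add: ipoly_def map_poly_pCons)

lemma ipoly_1 [simp]: "ipoly 1 x = 1"
  by (simp add: one_pCons)

lemma ipoly_add [simp]: "ipoly (f + g) x = ipoly f x + ipoly g x"
  by (induction f g rule: poly_induct2) (auto simp: algebra_simps)

lemma ipoly_smult [simp]: "ipoly (smult c f) x = of_int c * ipoly f x"
  by (induction f) (auto simp: algebra_simps)

lemma ipoly_minus [simp]: "ipoly (- f) x = - ipoly f x"
  using ipoly_smult[of "-1" f x] by simp

lemma ipoly_diff [simp]: "ipoly (f - g) x = ipoly f x - ipoly g x"
  using ipoly_add[of f "- g" x] by simp

lemma ipoly_mult [simp]: "ipoly (f * g) x = ipoly f x * ipoly g x"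
  by (induction f) (auto simp: algebra_simps)

lemma ipoly_pcompose [simp]: "ipoly (pcompose f g) x = ipoly f (ipoly g x)"
  by (induction f) (auto simp: pcompose_pCons)

lemma ipoly_power [simp]: "ipoly (f ^ k) x = ipoly f x ^ k"
  by (induction k) auto

lemma ipoly_of_int [simp]: "ipoly (of_int k) x = of_int k"
  by (simp add: of_int_poly)

lemma ipoly_of_real: "ipoly f (of_real x) = (of_real (ipoly f x) :: 'a::{real_algebra_1,comm_ring_1})"
  by (induction f) auto

subsection \<open>Algebraic integers and large primes\<close>

text \<open>Gauss's lemma: a primitive integer polynomial of least degree among those vanishing at
  \<open>z\<close> divides the monic \<open>M\<close> up to a constant, and comparing contents makes
  its leading coefficient a unit.\<close>

lemma integral_minimal_poly:
  fixes z :: "'a::{idom,ring_char_0}"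
  assumes M: "lead_coeff M = 1" "ipoly M z = 0"
  obtains g where "lead_coeff g = 1" "ipoly g z = 0"
    "\<And>h. ipoly h z = 0 \<Longrightarrow> degree h < degree g \<Longrightarrow> h = 0"
proof -
  define P where "P d \<longleftrightarrow> (\<exists>h. h \<noteq> 0 \<and> ipoly h z = 0 \<and> degree h = d)" for d
  define d where "d = (LEAST d. P d)"
  have "P (degree M)"
    using M unfolding P_def by (intro exI[of _ M]) auto
  then have "P d"
    unfolding d_def by (rule LeastI)
  then obtain h where h: "h \<noteq> 0" "ipoly h z = 0" "degree h = d"
    by (auto simp: P_def)
  have min: "f = 0" if "ipoly f z = 0" "degree f < d" for f
    using that not_less_Least[of "degree f" P] unfolding d_def P_def by blast
  define g where "g = primitive_part h"
  have hg: "h = smult (content h) g"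
    by (simp add: g_def)
  have g0: "g \<noteq> 0"
    using h by (simp add: g_def)
  have deg: "degree g = d"
    using h by (simp add: g_def)
  have "of_int (content h) * ipoly g z = 0"
    using h(2) by (subst (asm) hg) simp
  then have gz: "ipoly g z = 0"
    using h(1) by simp
  \<comment> \<open>Pseudo-division scales \<open>M\<close> by this power so that quotient and
    remainder stay integral.\<close>
  define c where "c = lead_coeff g ^ (Suc (degree M) - degree g)"
  obtain q r where qr: "pseudo_divmod M g = (q, r)"
    by fastforce
  note pd = pseudo_divmod[OF g0 qr, folded c_def]
  have "ipoly (smult c M) z = ipoly (g * q + r) z"
    using pd(1) by simp
  then have "ipoly r z = 0"
    using M gz by simp
  then have "r = 0"
    using min[of r] pd(2) deg by auto
  then have cM: "smult c M = g * q"
    using pd(1) by simp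
  have c0: "c \<noteq> 0"
    using g0 by (simp add: c_def)
  \<comment> \<open>\<open>M\<close> is monic and \<open>g\<close> primitive, so the content of
    \<open>q\<close> is the absolute value of \<open>c\<close>.\<close>
  have "content M dvd 1"
    using content_dvd_coeff[of M "degree M"] M(1) by simp
  then have "content M = 1"
    using is_unit_content_iff by blast
  then have "\<bar>c\<bar> = content q"
    using arg_cong[OF cM, of content] h(1) by (simp add: content_mult g_def)
  then obtain q' where q': "q = smult \<bar>c\<bar> q'"
    using content_times_primitive_part[of q] by metis
  have "c = lead_coeff (smult c M)"
    using M(1) by simp
  also have "\<dots> = lead_coeff g * (\<bar>c\<bar> * lead_coeff q')"
    by (simp add: cM q' lead_coeff_mult del: lead_coeff_smult flip: lead_coeff_smult)
  finally have "c = c * (lead_coeff g * (sgn c * lead_coeff q'))"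
    by (simp add: abs_sgn mult_ac)
  then have "lead_coeff g * (sgn c * lead_coeff q') = 1"
    using c0 by simp
  then have lg: "lead_coeff g * lead_coeff g = 1"
    by (metis zmult_eq_1_iff mult_minus1_right mult_1_right minus_minus)
  \<comment> \<open>The leading coefficient of \<open>g\<close> is 1 or -1; multiplying by it makes
    \<open>g\<close> monic.\<close>
  show ?thesis
  proof
    show "lead_coeff (smult (lead_coeff g) g) = 1"
      using lg g0 by simp
    show "ipoly (smult (lead_coeff g) g) z = 0"
      using gz by simp
    show "f = 0" if "ipoly f z = 0" "degree f < degree (smult (lead_coeff g) g)" for f
      using that min[of f] g0 deg by (auto split: if_splits)
  qed
qed

text \<open>With a monic minimal polynomial of degree d, the powers of \<open>z\<close> below d form
  a basis of Z[z] over the integers. All coordinates of a multiple of \<open>p\<close> are divisible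
  by \<open>p\<close>, so a nonzero coordinate bounds \<open>p\<close>.\<close>

lemma finitely_many_prime_divisors:
  fixes z :: "'a::{idom,ring_char_0}"
  assumes M: "lead_coeff M = 1" "ipoly M z = 0" and b: "ipoly b z \<noteq> 0"
  shows "\<exists>B. \<forall>p::nat. p > B \<longrightarrow> (\<forall>h. ipoly b z \<noteq> of_nat p * ipoly h z)"
proof -
  obtain g where g: "lead_coeff g = 1" "ipoly g z = 0"
    and min: "\<And>h. ipoly h z = 0 \<Longrightarrow> degree h < degree g \<Longrightarrow> h = 0"
    using integral_minimal_poly[OF M] by metis
  \<comment> \<open>Positive degree lets a zero remainder count as one of smaller degree.\<close>
  have deg: "degree g > 0"
  proof (rule ccontr)
    assume "\<not> degree g > 0"
    then have "g = [:1:]"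
      using g(1) by (auto elim: degree_eq_zeroE)
    then show False
      using g(2) by simp
  qed
  have red: "\<exists>r. ipoly h z = ipoly r z \<and> degree r < degree g" for h
  proof -
    have g0: "g \<noteq> 0"
      using g(1) by auto
    obtain q r where qr: "pseudo_divmod h g = (q, r)"
      by fastforce
    from pseudo_divmod[OF g0 this] g(1) have "h = g * q + r" "r = 0 \<or> degree r < degree g"
      by simp_all
    then show ?thesis
      using g(2) deg by (intro exI[of _ r]) auto
  qed
  obtain b' where b': "ipoly b z = ipoly b' z" "degree b' < degree g"
    using red by blast
  have "b' \<noteq> 0"
    using b b' by auto
  show ?thesis
  proof (intro exI[of _ "nat \<bar>lead_coeff b'\<bar>"] allI impI notI)
    fix p :: nat and h
    assume p: "p > nat \<bar>lead_coeff b'\<bar>" and eq: "ipoly b z = of_nat p * ipoly h z"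
    obtain r where r: "ipoly h z = ipoly r z" "degree r < degree g"
      using red by blast
    have "ipoly (b' - smult (int p) r) z = 0"
      using eq b' r by simp
    moreover have "degree (b' - smult (int p) r) < degree g"
      using b'(2) r(2) by (intro degree_diff_less) auto
    ultimately have "b' = smult (int p) r"
      using min by fastforce
    then have "int p dvd lead_coeff b'"
      by (metis coeff_smult dvd_triv_left)
    then show False
      using p \<open>b' \<noteq> 0\<close> zdvd_imp_le[of "int p" "\<bar>lead_coeff b'\<bar>"] by simp
  qed
qed

section \<open>Congruences modulo p in Z[z] and the Frobenius map\<close>

definition cong_adjoin :: "'a::comm_ring_1 \<Rightarrow> nat \<Rightarrow> 'a \<Rightarrow> 'a \<Rightarrow> bool" where
  "cong_adjoin z p a b \<longleftrightarrow> (\<exists>h. a - b = of_nat p * ipoly h z)"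

lemma cong_adjoin_refl [simp]: "cong_adjoin z p a a"
  unfolding cong_adjoin_def by (rule exI[of _ 0]) simp

lemma cong_adjoin_trans [trans]:
  assumes "cong_adjoin z p a b" "cong_adjoin z p b c" shows "cong_adjoin z p a c"
proof -
  obtain h k where "a - b = of_nat p * ipoly h z" "b - c = of_nat p * ipoly k z"
    using assms unfolding cong_adjoin_def by blast
  then have "a - c = of_nat p * ipoly (h + k) z"
    by (simp add: algebra_simps)
  then show ?thesis
    unfolding cong_adjoin_def by blast
qed

lemma cong_adjoin_sym: "cong_adjoin z p a b \<Longrightarrow> cong_adjoin z p b a"
  unfolding cong_adjoin_def by (metis ipoly_minus minus_diff_eq mult_minus_right)

lemma cong_adjoin_add:
  assumes "cong_adjoin z p a b" "cong_adjoin z p c d"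
  shows "cong_adjoin z p (a + c) (b + d)"
proof -
  obtain h k where "a - b = of_nat p * ipoly h z" "c - d = of_nat p * ipoly k z"
    using assms unfolding cong_adjoin_def by blast
  then have "a + c - (b + d) = of_nat p * ipoly (h + k) z"
    by (simp add: algebra_simps)
  then show ?thesis
    unfolding cong_adjoin_def by blast
qed

text \<open>For the values, \<open>a * c - b * d = (a - b) * c + b * (c - d)\<close>. The cofactors
  \<open>c\<close> and \<open>b\<close> must lie in Z[z] themselves, whereas
  \<open>cong_adjoin\<close> only speaks of differences.\<close>

lemma cong_adjoin_mult:
  assumes "cong_adjoin z p a b" "cong_adjoin z p (ipoly c z) (ipoly d z)" "b = ipoly e z"
  shows "cong_adjoin z p (a * ipoly c z) (b * ipoly d z)"
proof -
  obtain h k where "a - b = of_nat p * ipoly h z" "ipoly c z - ipoly d z = of_nat p * ipoly k z"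
    using assms unfolding cong_adjoin_def by blast
  then have "a * ipoly c z - b * ipoly d z = of_nat p * ipoly (h * c + e * k) z"
    using assms(3) by (simp add: algebra_simps)
  then show ?thesis
    unfolding cong_adjoin_def by blast
qed

text \<open>The inner binomial coefficients of row \<open>p\<close> are divisible by
  \<open>p\<close>.\<close>

lemma cong_adjoin_power_add:
  assumes "Factorial_Ring.prime p"
  shows "cong_adjoin z p ((ipoly f z + ipoly g z) ^ p) (ipoly f z ^ p + ipoly g z ^ p)"
proof -
  have p: "p > 1"
    using assms prime_gt_1_nat by blast
  define c where "c k = (p choose k) div p" for k
  have c: "p choose k = p * c k" if "k \<in> {1..<p}" for k
    using dvd_choose_prime[of k p] that assms by (auto simp: c_def)
  have "(ipoly f z + ipoly g z) ^ p =
      (\<Sum>k\<in>insert 0 (insert p {1..<p}). of_nat (p choose k) * ipoly f z ^ k * ipoly g z ^ (p - k))"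
    unfolding binomial_ring using p by (intro sum.cong) auto
  also have "\<dots> = ipoly g z ^ p + (ipoly f z ^ p +
      (\<Sum>k\<in>{1..<p}. of_nat (p choose k) * ipoly f z ^ k * ipoly g z ^ (p - k)))"
    using p by simp
  also have "(\<Sum>k\<in>{1..<p}. of_nat (p choose k) * ipoly f z ^ k * ipoly g z ^ (p - k)) =
      of_nat p * (\<Sum>k\<in>{1..<p}. ipoly (of_int (int (c k)) * f ^ k * g ^ (p - k)) z)"
    by (simp add: sum_distrib_left c mult.assoc del: of_int_of_nat_eq) simp
  also have "(\<Sum>k\<in>{1..<p}. ipoly (of_int (int (c k)) * f ^ k * g ^ (p - k)) z) =
      ipoly (\<Sum>k\<in>{1..<p}. of_int (int (c k)) * f ^ k * g ^ (p - k)) z"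
    by (induction rule: infinite_finite_induct) auto
  finally show ?thesis
    unfolding cong_adjoin_def by (auto simp: algebra_simps)
qed

text \<open>Fermat's little theorem for all integers. \<open>fermat_theorem\<close> covers natural
  numbers prime to \<open>p\<close>, hence the residue \<open>k\<close> and the separate case
  \<open>p dvd k\<close>.\<close>

lemma prime_dvd_power_diff:
  assumes "Factorial_Ring.prime (p::nat)"
  shows "int p dvd c ^ p - c"
proof -
  have p: "p > 0"
    using assms prime_gt_0_nat by blast
  define k where "k = nat (c mod int p)"
  have k: "[c = int k] (mod int p)"
    using p by (simp add: k_def cong_def)
  have "[k ^ p = k] (mod p)"
  proof (cases "p dvd k")
    case True
    then have "p dvd k ^ p"
      using p by (meson dvd_power dvd_trans)
    then show ?thesis
      using True by (simp add: cong_def)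
  next
    case False
    then have "[k * k ^ (p - 1) = k * 1] (mod p)"
      using fermat_theorem[OF assms] by (intro cong_mult) auto
    then show ?thesis
      using p by (simp flip: power_Suc)
  qed
  then have "[int k ^ p = int k] (mod int p)"
    by (metis cong_int_iff of_nat_power)
  then have "[c ^ p = c] (mod int p)"
    using k by (meson cong_pow cong_sym cong_trans)
  then show ?thesis
    by (simp add: cong_iff_dvd_diff)
qed

text \<open>Modulo \<open>p\<close>, the power map on Z[z] is additive and multiplicative and fixes
  the coefficients of \<open>f\<close>, so it commutes with evaluating \<open>f\<close>.\<close>

lemma cong_adjoin_frobenius:
  assumes "Factorial_Ring.prime p" "cong_adjoin z p (ipoly b z) (ipoly a z ^ p)"
  shows "cong_adjoin z p (ipoly f (ipoly b z)) (ipoly f (ipoly a z) ^ p)"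
proof (induction f)
  case 0
  then show ?case
    using assms(1) prime_gt_0_nat[of p] by (simp add: zero_power)
next
  case (pCons c f)
  obtain u v where u: "ipoly f (ipoly b z) = ipoly u z" and v: "ipoly f (ipoly a z) = ipoly v z"
    by (metis ipoly_pcompose)
  obtain k where k: "c ^ p - c = int p * k"
    using prime_dvd_power_diff[OF assms(1), of c] by auto
  have "of_int (c ^ p - c) = of_nat p * ipoly [:k:] z"
    by (subst k) simp
  then have "of_int c ^ p - of_int c = of_nat p * ipoly [:k:] z"
    by (simp only: of_int_diff of_int_power)
  then have c: "cong_adjoin z p (of_int c) (of_int c ^ p)"
    by (metis cong_adjoin_def cong_adjoin_sym)
  have "cong_adjoin z p (ipoly b z * ipoly u z) (ipoly a z ^ p * ipoly (v ^ p) z)"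
    using assms(2) pCons.IH u v by (intro cong_adjoin_mult[where e = "a ^ p"]) auto
  then have "cong_adjoin z p (of_int c + ipoly b z * ipoly u z)
      (of_int c ^ p + ipoly a z ^ p * ipoly (v ^ p) z)"
    using c by (rule cong_adjoin_add[rotated])
  also have "cong_adjoin z p \<dots> ((of_int c + ipoly a z * ipoly v z) ^ p)"
    using cong_adjoin_sym[OF cong_adjoin_power_add[OF assms(1), of z "[:c:]" "a * v"]]
    by (simp add: power_mult_distrib)
  finally show ?case
    by (simp add: u v)
qed

section \<open>Landau's argument for the conjugacy of cosines\<close>

lemma coprime_cong_large_prime_factors:
  fixes m N B :: nat
  assumes "coprime m N" "N > 0"
  obtains m' where "m' > 0" "[m' = m] (mod N)" "\<And>p. Factorial_Ring.prime p \<Longrightarrow> p dvd m' \<Longrightarrow> p > B"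
proof -
  \<comment> \<open>A prime up to \<open>B\<close> divides exactly one of \<open>m\<close> and
    \<open>N * Q\<close>, hence not their sum: if it divides \<open>m\<close>, it divides neither
    \<open>N\<close>, by coprimality, nor \<open>Q\<close>.\<close>
  define Q where "Q = \<Prod>{p\<in>{..B}. Factorial_Ring.prime p \<and> \<not> p dvd m}"
  have "Q > 0"
    unfolding Q_def by (intro prod_pos) (auto simp: prime_gt_0_nat)
  show ?thesis
  proof
    show "m + N * Q > 0"
      using assms(2) \<open>Q > 0\<close> by simp
    show "[m + N * Q = m] (mod N)"
      by (simp add: cong_def)
    fix p :: nat assume p: "Factorial_Ring.prime p" "p dvd m + N * Q"
    show "p > B"
    proof (rule ccontr)
      assume "\<not> p > B"
      have Q: "p dvd Q \<longleftrightarrow> \<not> p dvd m"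
      proof
        assume "p dvd Q"
        then obtain q where "Factorial_Ring.prime q" "\<not> q dvd m" "p dvd q"
          unfolding Q_def using p(1) by (auto simp: prime_dvd_prod_iff)
        then show "\<not> p dvd m"
          using p(1) primes_dvd_imp_eq by blast
      next
        assume "\<not> p dvd m"
        then show "p dvd Q"
          unfolding Q_def using p(1) \<open>\<not> p > B\<close> by (intro dvd_prodI[where f = "\<lambda>x. x", simplified]) auto
      qed
      show False
      proof (cases "p dvd m")
        case True
        then have "p dvd N * Q"
          using p(2) by (simp add: dvd_add_right_iff)
        then have "p dvd N"
          using True Q p(1) prime_dvd_mult_iff by blast
        then show False
          using True assms(1) p(1) coprime_common_divisor not_prime_unit by blast
      next
        case False
        then have "p dvd N * Q"
          using Q by simp
        then show False
          using False p(2) by (simp add: dvd_add_left_iff)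
      qed
    qed
  qed
qed

text \<open>A large prime \<open>p\<close> carries a zero of \<open>f\<close> from index
  \<open>j\<close> to index \<open>j * p\<close>, and modulo \<open>N\<close> the factor
  \<open>m\<close> is a product of large primes.\<close>

lemma ipoly_cos_conjugate:
  fixes N j m :: nat
  assumes N: "N > 0" and m: "coprime m N"
    and "ipoly f (2 * cos (2 * pi * real j / real N)) = 0"
  shows "ipoly f (2 * cos (2 * pi * real (j * m) / real N)) = 0"
proof -
  define x where "x k = 2 * cos (2 * pi * real k / real N)" for k :: nat
  define z where "z = cis (2 * pi / real N)"
  have zN: "z ^ N = 1"
    unfolding z_def Complex.DeMoivre using N by simp
  \<comment> \<open>As \<open>z ^ N = 1\<close>, the exponent \<open>(N - 1) * k\<close> stands for
    \<open>- k\<close>, so that \<open>x k\<close> becomes the value of an integer polynomial at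
    \<open>z\<close>.\<close>
  define y where "y k = monom (1::int) k + monom 1 ((N - 1) * k)" for k
  have mon: "ipoly (monom 1 k) z = z ^ k" for k
    by (induction k) (auto simp: monom_0 monom_Suc)
  have zinv: "z ^ ((N - 1) * k) = cis (- (2 * pi * real k / real N))" for k
  proof -
    have "z ^ ((N - 1) * k) * z ^ k = (z ^ N) ^ k"
      using N by (metis One_nat_def Suc_pred mult_Suc power_add power_mult add.commute)
    then have "z ^ ((N - 1) * k) = inverse (z ^ k)"
      using zN by (metis inverse_unique mult.commute power_one)
    also have "z ^ k = cis (2 * pi * real k / real N)"
      by (simp add: z_def Complex.DeMoivre mult_ac)
    finally show ?thesis
      by (simp add: cis_inverse)
  qed
  have zk: "z ^ k = cis (2 * pi * real k / real N)" for k
    by (simp add: z_def Complex.DeMoivre mult_ac)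
  have y: "of_real (x k) = ipoly (y k) z" for k
    unfolding y_def ipoly_add mon zinv zk[of k] by (simp add: x_def complex_eq_iff)
  have fX: "of_real (ipoly f (x k)) = ipoly f (ipoly (y k) z)" for k
    by (simp flip: y add: ipoly_of_real)
  \<comment> \<open>Only indices below \<open>N\<close> matter, so a single bound \<open>C\<close>
    serves all of them.\<close>
  have periodic: "x k = x k'" if "[k = k'] (mod N)" for k k'
  proof -
    have "z ^ k = z ^ k'" if "k = k' mod N" for k k'
    proof -
      have "z ^ k' = z ^ (N * (k' div N) + k)"
        using that by simp
      also have "\<dots> = z ^ k"
        by (simp add: power_add power_mult zN)
      finally show ?thesis ..
    qed
    then have "z ^ k = z ^ k'"
      using that unfolding cong_def by metis
    then show ?thesis
      unfolding zk x_def by (metis cis.simps(1))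
  qed
  have "\<exists>B. \<forall>p::nat. p > B \<longrightarrow> ipoly f (x k) \<noteq> 0 \<longrightarrow>
      (\<forall>h. of_real (ipoly f (x k)) \<noteq> of_nat p * ipoly h z)" for k
  proof (cases "ipoly f (x k) = 0")
    case False
    \<comment> \<open>This polynomial certifies that \<open>z\<close> is an algebraic
      integer.\<close>
    define M where "M = monom (1::int) N - 1"
    have "lead_coeff M = 1"
    proof -
      have "degree M = N"
        unfolding M_def using N by (intro antisym degree_le le_degree) (auto simp: coeff_monom coeff_1)
      then show ?thesis
        using N by (simp add: M_def)
    qed
    moreover have "ipoly M z = 0"
      by (simp add: M_def mon zN)
    moreover obtain b where "ipoly f (ipoly (y k) z) = ipoly b z"
      by (metis ipoly_pcompose)
    ultimately show ?thesis
      using finitely_many_prime_divisors[of M z b] False fX[of k] by (metis of_real_eq_0_iff)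
  qed auto
  then obtain B where B: "\<And>k p h. p > B k \<Longrightarrow> ipoly f (x k) \<noteq> 0 \<Longrightarrow>
      of_real (ipoly f (x k)) \<noteq> of_nat p * ipoly h z"
    by metis
  define C where "C = Max (B ` {..<N})"
  have step: "ipoly f (x (j * p)) = 0"
    if "ipoly f (x j) = 0" "Factorial_Ring.prime p" "p > C" for j p
  proof (rule ccontr)
    assume nz: "ipoly f (x (j * p)) \<noteq> 0"
    define k where "k = (j * p) mod N"
    have k: "x (j * p) = x k" "k < N"
      using N by (auto intro: periodic simp: k_def cong_def)
    have "B k \<le> C"
      using k(2) unfolding C_def by (intro Max_ge) auto
    \<comment> \<open>\<open>y (j * p)\<close> is congruent to \<open>y j ^ p\<close>, so by
      Frobenius \<open>f\<close> at \<open>x (j * p)\<close> is congruent to a power of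
      \<open>f\<close> at \<open>x j\<close>, which is 0. Then \<open>p\<close> divides a nonzero
      value, against the choice of \<open>B\<close>.\<close>
    have "cong_adjoin z p ((ipoly (monom 1 j) z + ipoly (monom 1 ((N - 1) * j)) z) ^ p)
        (ipoly (monom 1 j) z ^ p + ipoly (monom 1 ((N - 1) * j)) z ^ p)"
      using that(2) by (rule cong_adjoin_power_add)
    from cong_adjoin_sym[OF this] have "cong_adjoin z p (ipoly (y (j * p)) z) (ipoly (y j) z ^ p)"
      by (simp add: y_def mon mult_ac flip: power_mult)
    then have "cong_adjoin z p (ipoly f (ipoly (y (j * p)) z)) (ipoly f (ipoly (y j) z) ^ p)"
      by (rule cong_adjoin_frobenius[OF that(2)])
    then have "cong_adjoin z p (of_real (ipoly f (x (j * p)))) 0"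
      using that(1,2) by (simp flip: fX add: prime_gt_0_nat zero_power)
    then show False
      using B[of k p] nz k \<open>B k \<le> C\<close> that(3) by (auto simp: cong_adjoin_def)
  qed
  \<comment> \<open>The primes of \<open>m\<close> are absorbed into \<open>j\<close> one by one, so
    \<open>j\<close> has to be general in the induction.\<close>
  have large: "ipoly f (x (j * m)) = 0"
    if "m > 0" "\<And>p. Factorial_Ring.prime p \<Longrightarrow> p dvd m \<Longrightarrow> p > C" "ipoly f (x j) = 0" for m j
    using that
  proof (induction m arbitrary: j rule: prime_divisors_induct)
    case (factor p m)
    have "ipoly f (x (j * p)) = 0"
      using step factor.prems factor.hyps by simp
    moreover have "q > C" if "Factorial_Ring.prime q" "q dvd m" for q
      using factor.prems(2)[of q] that by simp
    ultimately have "ipoly f (x (j * p * m)) = 0"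
      using factor.prems(1) by (intro factor.IH) auto
    then show ?case
      by (simp add: mult_ac)
  qed auto
  obtain m' where m': "m' > 0" "[m' = m] (mod N)" "\<And>p. Factorial_Ring.prime p \<Longrightarrow> p dvd m' \<Longrightarrow> p > C"
    using coprime_cong_large_prime_factors[OF m N] by blast
  have "ipoly f (x (j * m')) = 0"
    using assms(3) by (intro large m') (auto simp: x_def)
  moreover have "x (j * m') = x (j * m)"
    using m'(2) by (intro periodic cong_mult) auto
  ultimately show ?thesis
    by (simp add: x_def)
qed

subsection \<open>Dickson polynomials\<close>

text \<open>Chebyshev polynomials rescaled to \<open>2 * T_k (x / 2)\<close>, the normalisation that
  sends \<open>w + inverse w\<close> to \<open>w ^ k + inverse w ^ k\<close>.\<close>

fun dickson :: "nat \<Rightarrow> int poly" where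
  "dickson 0 = [:2:]"
| "dickson (Suc 0) = [:0, 1:]"
| "dickson (Suc (Suc k)) = [:0, 1:] * dickson (Suc k) - dickson k"

lemma ipoly_dickson:
  fixes w :: "'a::field"
  assumes "w \<noteq> 0"
  shows "ipoly (dickson k) (w + inverse w) = w ^ k + inverse w ^ k"
  using assms by (induction k rule: dickson.induct) (auto simp: field_simps power2_eq_square)

lemma ipoly_dickson_cos: "ipoly (dickson k) (2 * cos t) = 2 * cos (real k * t)"
proof -
  have "complex_of_real (ipoly (dickson k) (2 * cos t)) = ipoly (dickson k) (cis t + inverse (cis t))"
    unfolding ipoly_of_real[symmetric] by (rule arg_cong[where f = "ipoly _"]) (simp add: complex_eq_iff)
  also have "\<dots> = of_real (2 * cos (real k * t))"
    by (subst ipoly_dickson[OF cis_neq_zero]) (auto simp: cis_inverse Complex.DeMoivre complex_eq_iff)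
  finally show ?thesis
    by (simp only: of_real_eq_iff)
qed

text \<open>For \<open>y = w + inverse w\<close> the hypothesis becomes
  \<open>w ^ N + inverse w ^ N = 2\<close>, that is \<open>(w ^ N - 1) ^ 2 = 0\<close>. So
  \<open>w\<close> is a root of unity and \<open>y\<close> is twice its real part.\<close>

lemma dickson_eq_2_imp_cos:
  fixes y :: real
  assumes "N > 0" "ipoly (dickson N) y = 2"
  obtains k :: nat where "y = 2 * cos (2 * pi * real k / real N)"
proof -
  \<comment> \<open>The quadratic formula for \<open>w ^ 2 - y * w + 1 = 0\<close>, over the complex
    numbers because the discriminant may be negative.\<close>
  define s where "s = csqrt (of_real y ^ 2 - 4)"
  define w where "w = (of_real y + s) / 2"
  have "s ^ 2 = of_real y ^ 2 - 4"
    by (simp add: s_def)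
  moreover have "w * (of_real y - w) = (of_real y ^ 2 - s ^ 2) / 4"
    by (simp add: w_def field_simps power2_eq_square)
  ultimately have "w * (of_real y - w) = 1"
    by simp
  then have "w \<noteq> 0" and inv: "inverse w = of_real y - w"
    by (auto simp: inverse_unique)
  have "ipoly (dickson N) (w + inverse w) = (2::complex)"
    using arg_cong[OF assms(2), of complex_of_real] by (simp add: inv flip: ipoly_of_real)
  then have "w ^ N + inverse w ^ N = 2"
    using ipoly_dickson[OF \<open>w \<noteq> 0\<close>, of N] by simp
  then have "w ^ N * (w ^ N + inverse (w ^ N)) = w ^ N * 2"
    by (simp add: power_inverse)
  then have "(w ^ N - 1) ^ 2 = 0"
    using \<open>w \<noteq> 0\<close> by (simp add: ring_distribs power2_eq_square)
  then have "w \<in> {z. z ^ N = 1}"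
    by simp
  then obtain k where k: "w = cis (2 * pi * real k / real N)"
    using Complex.bij_betw_roots_unity[OF assms(1)] unfolding bij_betw_def by blast
  have "of_real y = w + inverse w"
    by (simp add: inv)
  then have "y = 2 * cos (2 * pi * real k / real N)"
    by (simp add: k complex_eq_iff cis_inverse)
  then show ?thesis
    by (rule that)
qed

text \<open>Arbitrary integers serve as indices, so that automorphisms act by multiplying the
  index.\<close>

definition rho_conj :: "nat \<Rightarrow> int \<Rightarrow> real" where
  "rho_conj n k = 2 * cos (pi * real_of_int k / real n)"

lemma rho_conj_1: "rho_conj n 1 = rho n"
  by (simp add: rho_conj_def rho_def)

lemma ipoly_dickson_rho_conj: "ipoly (dickson k) (rho_conj n j) = rho_conj n (int k * j)"
  by (simp add: rho_conj_def ipoly_dickson_cos mult_ac)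

subsection \<open>The Modd group\<close>

text \<open>Equality modulo \<open>2 * n\<close> up to sign, kept as a relation on integers so that
  representatives can be compared without forming a quotient.\<close>

definition cong_pm :: "nat \<Rightarrow> int \<Rightarrow> int \<Rightarrow> bool" where
  "cong_pm n a b \<longleftrightarrow> 2 * int n dvd a - b \<or> 2 * int n dvd a + b"

lemma rho_conj_cong:
  assumes "n > 0" "cong_pm n a b"
  shows "rho_conj n a = rho_conj n b"
proof -
  have *: "rho_conj n (b + 2 * int n * c) = rho_conj n b" for b c
  proof -
    have "pi * real_of_int (b + 2 * int n * c) / real n = pi * real_of_int b / real n + 2 * pi * of_int c"
      using assms(1) by (simp add: field_simps)
    then show ?thesis
      unfolding rho_conj_def by (simp only: mult_cancel_left) (auto intro!: cos_eq_periodic_intro[where k = c])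
  qed
  from assms(2) show ?thesis
    unfolding cong_pm_def
  proof
    assume "2 * int n dvd a - b"
    then obtain c where "a = b + 2 * int n * c"
      by (metis add.commute diff_add_cancel dvdE)
    then show ?thesis
      using * by simp
  next
    assume "2 * int n dvd a + b"
    then obtain c where "a = - b + 2 * int n * c"
      by (metis add.commute add_diff_cancel_left' dvdE uminus_add_conv_diff)
    then have "rho_conj n a = rho_conj n (- b)"
      using *[of "- b" c] by simp
    then show ?thesis
      by (simp add: rho_conj_def)
  qed
qed

lemma cong_pm_sym: "cong_pm n a b \<Longrightarrow> cong_pm n b a"
  unfolding cong_pm_def by (metis add.commute dvd_minus_iff minus_diff_eq)

lemma cong_pm_trans [trans]:
  assumes "cong_pm n a b" "cong_pm n b c" shows "cong_pm n a c"
proof -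
  have "2 * int n dvd a - c" if "2 * int n dvd a - b" "2 * int n dvd b - c"
    using dvd_add[OF that] by simp
  moreover have "2 * int n dvd a - c" if "2 * int n dvd a + b" "2 * int n dvd b + c"
    using dvd_diff[OF that] by simp
  moreover have "2 * int n dvd a + c" if "2 * int n dvd a - b" "2 * int n dvd b + c"
    using dvd_add[OF that] by simp
  moreover have "2 * int n dvd a + c" if "2 * int n dvd a + b" "2 * int n dvd b - c"
    using dvd_diff[OF that] by simp
  ultimately show ?thesis
    using assms unfolding cong_pm_def by blast
qed

lemma cong_pm_mult:
  assumes "cong_pm n a b" shows "cong_pm n (a * c) (b * c)"
  using assms unfolding cong_pm_def by (metis distrib_right dvd_mult2 left_diff_distrib)

text \<open>Being odd and coprime to \<open>n\<close> merge into coprimality to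
  \<open>2 * n\<close>, the modulus of \<open>cong_pm\<close>.\<close>

lemma mem_modd_units_iff:
  "m \<in> modd_units n \<longleftrightarrow> coprime m (2 * int n) \<and> 1 \<le> m \<and> m < int n"
  by (auto simp: modd_units_def simp flip: coprime_iff_gcd_eq_1)

lemma modd_sign_eq_1_iff:
  "modd_sign n k = 1 \<longleftrightarrow> even (k div int n)"
proof -
  have "\<lfloor>real_of_int k / real n\<rfloor> = k div int n"
    by (metis floor_divide_of_int_eq of_int_of_nat_eq)
  then show ?thesis
    by (simp add: modd_sign_def power_int_minus_one_minus power_int_def minus_one_power_iff even_nat_iff)
qed

text \<open>An even quotient changes \<open>k\<close> by a multiple of \<open>2 * n\<close>; an odd
  one makes \<open>n - k mod n\<close> congruent to \<open>- k\<close>.\<close>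

lemma cong_pm_modd:
  assumes "\<not> int n dvd k"
  shows "cong_pm n (modd n k) k"
proof (cases "even (k div int n)")
  case True
  then obtain c where "k div int n = 2 * c" by blast
  then have "k mod int n - k = - (2 * int n * c)"
    by (simp add: minus_div_mult_eq_mod[symmetric] mult_ac)
  then show ?thesis
    using True by (simp add: cong_pm_def modd_def modd_sign_eq_1_iff modd_rem_def)
next
  case False
  then obtain c where "k div int n = 2 * c + 1" by (elim oddE)
  then have "int n - k mod int n + k = 2 * int n * (c + 1)"
    by (simp add: minus_div_mult_eq_mod[symmetric] algebra_simps)
  \<comment> \<open>For an odd multiple \<open>k\<close> of \<open>n\<close> the value would be 0
    instead of \<open>n\<close>, and 0 is not congruent to \<open>k\<close>; hence the
    assumption.\<close>
  moreover have "modd n k = int n - k mod int n"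
    using False assms
    by (simp add: modd_def modd_sign_eq_1_iff modd_rem_def zmod_zminus1_eq_if dvd_eq_mod_eq_0)
  ultimately show ?thesis
    by (simp add: cong_pm_def)
qed

lemma coprime_cong_pm:
  assumes "cong_pm n a b" "coprime b (2 * int n)"
  shows "coprime a (2 * int n)"
proof (rule coprimeI)
  fix d assume d: "d dvd a" "d dvd 2 * int n"
  then have "d dvd a - b \<or> d dvd a + b"
    using assms(1) dvd_trans unfolding cong_pm_def by blast
  then have "d dvd b"
    using d(1) by (auto simp: dvd_diff_right_iff dvd_add_right_iff)
  then show "d dvd 1"
    using d(2) assms(2) coprime_common_divisor by blast
qed

text \<open>Existence of a representative. As \<open>n \<ge> 2\<close> divides \<open>2 * n\<close>,
  it cannot also divide \<open>k\<close>, and \<open>cong_pm_modd\<close> applies.\<close>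

lemma modd_mem_units:
  assumes "n \<ge> 2" "coprime k (2 * int n)"
  shows "modd n k \<in> modd_units n" "cong_pm n (modd n k) k"
proof -
  have "\<not> int n dvd k"
    using assms coprime_common_divisor[of k "2 * int n" "int n"] by auto
  then show *: "cong_pm n (modd n k) k"
    by (rule cong_pm_modd)
  from coprime_cong_pm[OF this assms(2)] have cop: "coprime (modd n k) (2 * int n)" .
  have "modd n k \<noteq> 0"
    using cop assms(1) by auto
  moreover have "0 \<le> modd n k" "modd n k < int n"
    using assms(1) by (auto simp: modd_def modd_rem_def)
  ultimately show "modd n k \<in> modd_units n"
    using cop by (simp add: mem_modd_units_iff)
qed

text \<open>Uniqueness of the representative: a sum of two units lies strictly between 0 and
  \<open>2 * n\<close>, and their difference is below \<open>n\<close> in absolute value.\<close>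

lemma cong_pm_units_imp_eq:
  assumes "a \<in> modd_units n" "b \<in> modd_units n" "cong_pm n a b"
  shows "a = b"
proof -
  have a: "1 \<le> a" "a < int n" and b: "1 \<le> b" "b < int n"
    using assms by (auto simp: modd_units_def)
  have "\<not> 2 * int n dvd a + b"
    using a b zdvd_not_zless by force
  then have "2 * int n dvd a - b"
    using assms(3) by (auto simp: cong_pm_def)
  then show ?thesis
    using a b zdvd_not_zless[of "a - b" "2 * int n"] zdvd_not_zless[of "b - a" "2 * int n"]
    by (smt (verit) dvd_minus_iff minus_diff_eq)
qed

lemma coprime_inverse_mod:
  assumes "coprime k (2 * int n)"
  obtains y where "coprime y (2 * int n)" "cong_pm n (y * k) 1"
proof -
  obtain y where y: "[k * y = 1] (mod (2 * int n))"
    using cong_solve_coprime_int[OF assms] by blast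
  then have "coprime (k * y) (2 * int n)"
    by (metis cong_imp_coprime cong_sym coprime_1_left)
  then have "coprime y (2 * int n)"
    by simp
  moreover have "cong_pm n (y * k) 1"
    using y by (simp add: cong_pm_def cong_iff_dvd_diff mult.commute)
  ultimately show ?thesis
    by (rule that)
qed

text \<open>The laws hold up to \<open>cong_pm\<close> for the underlying integer products;
  \<open>cong_pm_units_imp_eq\<close> turns congruent representatives into equal ones.\<close>

lemma group_modd_monoid:
  assumes "n \<ge> 2"
  shows "group (modd_monoid n)"
proof -
  have closed: "modd n (a * b) \<in> modd_units n" "cong_pm n (modd n (a * b)) (a * b)"
    if "a \<in> modd_units n" "b \<in> modd_units n" for a b
  proof -
    have "coprime (a * b) (2 * int n)"
      using that by (simp add: mem_modd_units_iff)
    then show "modd n (a * b) \<in> modd_units n" "cong_pm n (modd n (a * b)) (a * b)"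
      using modd_mem_units[OF assms] by blast+
  qed
  show ?thesis
  proof (rule groupI, simp_all add: modd_monoid_def)
    show "modd n (a * b) \<in> modd_units n" if "a \<in> modd_units n" "b \<in> modd_units n" for a b
      using closed that by blast
    show one: "1 \<in> modd_units n"
      using assms by (simp add: modd_units_def)
    show "modd n a = a" if "a \<in> modd_units n" for a
      using closed[OF one that] that by (intro cong_pm_units_imp_eq) auto
    show "modd n (modd n (a * b) * c) = modd n (a * modd n (b * c))"
      if "a \<in> modd_units n" "b \<in> modd_units n" "c \<in> modd_units n" for a b c
    proof (rule cong_pm_units_imp_eq)
      show "modd n (modd n (a * b) * c) \<in> modd_units n" "modd n (a * modd n (b * c)) \<in> modd_units n"
        by (intro closed that)+
      have "cong_pm n (modd n (modd n (a * b) * c)) (modd n (a * b) * c)"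
        using closed that by blast
      also have "cong_pm n \<dots> (a * b * c)"
        using closed that by (blast intro: cong_pm_mult)
      \<comment> \<open>Commuted because \<open>cong_pm_mult\<close> multiplies on the
        right.\<close>
      also have "a * b * c = b * c * a"
        by simp
      also have "cong_pm n \<dots> (modd n (b * c) * a)"
        using closed that by (blast intro: cong_pm_mult cong_pm_sym)
      also have "modd n (b * c) * a = a * modd n (b * c)"
        by simp
      also have "cong_pm n \<dots> (modd n (a * modd n (b * c)))"
        using closed that by (blast intro: cong_pm_sym)
      finally show "cong_pm n (modd n (modd n (a * b) * c)) (modd n (a * modd n (b * c)))" .
    qed
    show "\<exists>y\<in>modd_units n. modd n (y * a) = 1" if a: "a \<in> modd_units n" for a
    proof -
      obtain y where y: "coprime y (2 * int n)" "cong_pm n (y * a) 1"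
        using a coprime_inverse_mod[of a n] by (auto simp: mem_modd_units_iff)
      \<comment> \<open>The inverse modulo \<open>2 * n\<close> is itself replaced by its
        representative.\<close>
      note y' = modd_mem_units[OF assms y(1)]
      have "cong_pm n (modd n (modd n y * a)) (modd n y * a)"
        using closed y' a by blast
      also have "cong_pm n \<dots> (y * a)"
        using y' by (blast intro: cong_pm_mult)
      also note y(2)
      finally have "modd n (modd n y * a) = 1"
        using closed y' a one by (intro cong_pm_units_imp_eq) auto
      then show ?thesis
        using y'(1) by blast
    qed
  qed
qed

subsection \<open>Homomorphisms of simple extensions of the rationals\<close>

lemma rat_adjoin_simps [simp]:
  "a \<oplus>\<^bsub>rat_adjoin x\<^esub> b = a + b" "a \<otimes>\<^bsub>rat_adjoin x\<^esub> b = a * b" "\<one>\<^bsub>rat_adjoin x\<^esub> = 1"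
  by (simp_all add: rat_adjoin_def ring_of_type_algebra_def)

lemma inv_ring_of_type_algebra:
  fixes a :: "'a::field"
  assumes "a \<noteq> 0"
  shows "inv\<^bsub>ring_of_type_algebra\<^esub> a = inverse a"
proof -
  interpret ring "ring_of_type_algebra :: 'a ring"
    by (rule ring_from_type_algebra)
  show ?thesis
    by (rule inv_unique'[symmetric]) (use assms in \<open>auto simp: ring_of_type_algebra_def\<close>)
qed

section \<open>The elements of Q(x)\<close>

lemma rat_adjoin_closed:
  shows rat_adjoin_base: "x \<in> carrier (rat_adjoin x)"
    and rat_adjoin_add: "a \<in> carrier (rat_adjoin x) \<Longrightarrow> b \<in> carrier (rat_adjoin x) \<Longrightarrow> a + b \<in> carrier (rat_adjoin x)"
    and rat_adjoin_mult: "a \<in> carrier (rat_adjoin x) \<Longrightarrow> b \<in> carrier (rat_adjoin x) \<Longrightarrow> a * b \<in> carrier (rat_adjoin x)"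
    and rat_adjoin_inverse: "a \<in> carrier (rat_adjoin x) \<Longrightarrow> inverse a \<in> carrier (rat_adjoin x)"
    and rat_adjoin_of_int: "of_int c \<in> carrier (rat_adjoin x)"
proof -
  let ?R = "ring_of_type_algebra :: real ring"
  have *: "carrier (rat_adjoin x) = generate_field ?R (insert x \<rat>)"
    by (simp add: rat_adjoin_def)
  have R: "a + b = a \<oplus>\<^bsub>?R\<^esub> b" "a * b = a \<otimes>\<^bsub>?R\<^esub> b" "\<zero>\<^bsub>?R\<^esub> = 0" for a b
    by (simp_all add: ring_of_type_algebra_def)
  show "x \<in> carrier (rat_adjoin x)" "of_int c \<in> carrier (rat_adjoin x)"
    by (auto simp: * intro: generate_field.incl)
  show "a \<in> carrier (rat_adjoin x) \<Longrightarrow> b \<in> carrier (rat_adjoin x) \<Longrightarrow> a + b \<in> carrier (rat_adjoin x)"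
    unfolding * R by (rule generate_field.eng_add)
  show "a \<in> carrier (rat_adjoin x) \<Longrightarrow> b \<in> carrier (rat_adjoin x) \<Longrightarrow> a * b \<in> carrier (rat_adjoin x)"
    unfolding * R by (rule generate_field.eng_mult)
  show "inverse a \<in> carrier (rat_adjoin x)" if "a \<in> carrier (rat_adjoin x)"
  \<comment> \<open>At zero, closure rests on the convention \<open>inverse 0 = 0\<close>.\<close>
  proof (cases "a = 0")
    case False
    then show ?thesis
      using generate_field.m_inv[of a ?R "insert x \<rat>"] that
      by (simp add: * R inv_ring_of_type_algebra)
  qed (use that in auto)
qed

lemma rat_adjoin_ipoly:
  assumes "y \<in> carrier (rat_adjoin x)"
  shows "ipoly f y \<in> carrier (rat_adjoin x)"
proof (induction f)
  case 0
  then show ?case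
    using rat_adjoin_of_int[of 0] by simp
next
  case (pCons c f)
  then show ?case
    using assms by (auto intro: rat_adjoin_add rat_adjoin_mult rat_adjoin_of_int)
qed

text \<open>Fractions of polynomial values are closed under the field operations, and clearing
  denominators leaves integer coefficients. This avoids choosing a minimal polynomial of
  \<open>x\<close>.\<close>

lemma carrier_rat_adjoin:
  "carrier (rat_adjoin x) = {ipoly f x / ipoly h x |f h. ipoly h x \<noteq> 0}"
proof (intro equalityI subsetI)
  fix y assume "y \<in> carrier (rat_adjoin x)"
  then have "y \<in> generate_field ring_of_type_algebra (insert x \<rat>)"
    by (simp add: rat_adjoin_def)
  then show "y \<in> {ipoly f x / ipoly h x |f h. ipoly h x \<noteq> 0}"
  proof induction
    case one
    have "\<one>\<^bsub>ring_of_type_algebra\<^esub> = ipoly 1 x / ipoly 1 x" "ipoly 1 x \<noteq> 0"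
      by (simp_all add: ring_of_type_algebra_def)
    then show ?case by blast
  next
    case (incl y)
    then show ?case
    proof
      assume "y = x"
      then have "y = ipoly [:0, 1:] x / ipoly 1 x" "ipoly 1 x \<noteq> 0"
        by simp_all
      then show ?case by blast
    next
      assume "y \<in> \<rat>"
      then obtain a b where "b > 0" "y = of_int a / of_int b"
        by (rule Rats_cases') auto
      then have "y = ipoly [:a:] x / ipoly [:b:] x" "ipoly [:b:] x \<noteq> 0"
        by simp_all
      then show ?case by blast
    qed
  next
    case (a_inv y)
    then obtain f h where fh: "y = ipoly f x / ipoly h x" "ipoly h x \<noteq> 0"
      by blast
    interpret ring "ring_of_type_algebra :: real ring"
      by (rule ring_from_type_algebra)
    have "\<ominus>\<^bsub>ring_of_type_algebra\<^esub> y = - y"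
      by (rule minus_equality) (auto simp: ring_of_type_algebra_def)
    then have "\<ominus>\<^bsub>ring_of_type_algebra\<^esub> y = ipoly (- f) x / ipoly h x"
      using fh by simp
    then show ?case
      using fh by blast
  next
    case (m_inv y)
    then obtain f h where fh: "y = ipoly f x / ipoly h x" "ipoly h x \<noteq> 0"
      by blast
    have "y \<noteq> 0"
      using m_inv by (simp add: ring_of_type_algebra_def)
    then have "inv\<^bsub>ring_of_type_algebra\<^esub> y = ipoly h x / ipoly f x" "ipoly f x \<noteq> 0"
      using fh by (auto simp: inv_ring_of_type_algebra)
    then show ?case by blast
  next
    case (eng_add y z)
    then obtain f h g k where "y = ipoly f x / ipoly h x" "ipoly h x \<noteq> 0"
      "z = ipoly g x / ipoly k x" "ipoly k x \<noteq> 0"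
      by blast
    then have "y \<oplus>\<^bsub>ring_of_type_algebra\<^esub> z = ipoly (f * k + g * h) x / ipoly (h * k) x"
      "ipoly (h * k) x \<noteq> 0"
      by (simp_all add: ring_of_type_algebra_def add_frac_eq)
    then show ?case by blast
  next
    case (eng_mult y z)
    then obtain f h g k where "y = ipoly f x / ipoly h x" "ipoly h x \<noteq> 0"
      "z = ipoly g x / ipoly k x" "ipoly k x \<noteq> 0"
      by blast
    then have "y \<otimes>\<^bsub>ring_of_type_algebra\<^esub> z = ipoly (f * g) x / ipoly (h * k) x"
      "ipoly (h * k) x \<noteq> 0"
      by (simp_all add: ring_of_type_algebra_def)
    then show ?case by blast
  qed
next
  fix y assume "y \<in> {ipoly f x / ipoly h x |f h. ipoly h x \<noteq> 0}"
  then show "y \<in> carrier (rat_adjoin x)"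
    by (auto simp: divide_inverse intro!: rat_adjoin_mult rat_adjoin_inverse rat_adjoin_ipoly rat_adjoin_base)
qed

text \<open>\<open>ring_hom\<close> records sums, products and one on the carrier, so zero, the
  naturals and the negative integers come first; Horner's scheme does the rest.\<close>

lemma ring_hom_rat_adjoin_ipoly:
  assumes \<tau>: "\<tau> \<in> ring_hom (rat_adjoin x) (rat_adjoin x)" and y: "y \<in> carrier (rat_adjoin x)"
  shows "\<tau> (ipoly f y) = ipoly f (\<tau> y)"
proof -
  let ?L = "carrier (rat_adjoin x)"
  have add: "\<tau> (a + b) = \<tau> a + \<tau> b" and mult: "\<tau> (a * b) = \<tau> a * \<tau> b" if "a \<in> ?L" "b \<in> ?L" for a b
    using ring_hom_add[OF \<tau> that] ring_hom_mult[OF \<tau> that] by simp_all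
  have one: "\<tau> 1 = 1"
    using ring_hom_one[OF \<tau>] by simp
  have zero: "\<tau> 0 = 0"
    using add[of 0 0] rat_adjoin_of_int[of 0] by simp
  have nat: "\<tau> (of_nat k) = of_nat k" for k
  proof (induction k)
    case (Suc k)
    then show ?case
      using add[of 1 "of_nat k"] one rat_adjoin_of_int[of 1 x] rat_adjoin_of_int[of "int k" x] by simp
  qed (simp add: zero)
  have int: "\<tau> (of_int c) = of_int c" for c
  proof (cases c)
    case (nonneg k)
    then show ?thesis by (simp add: nat)
  next
    case (neg k)
    have "\<tau> (of_int c + of_nat (Suc k)) = \<tau> (of_int c) + \<tau> (of_nat (Suc k))"
      using rat_adjoin_of_int[of c x] rat_adjoin_of_int[of "int (Suc k)" x] by (intro add) auto
    moreover have "real_of_int c + of_nat (Suc k) = 0"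
      using neg by simp
    ultimately show ?thesis
      using neg zero nat[of "Suc k"] by simp
  qed
  show ?thesis
  proof (induction f)
    case (pCons c f)
    then show ?case
      using y by (simp add: add mult int rat_adjoin_of_int rat_adjoin_mult rat_adjoin_ipoly)
  qed (simp add: zero)
qed

lemma ring_hom_rat_adjoin_divide:
  assumes \<tau>: "\<tau> \<in> ring_hom (rat_adjoin x) (rat_adjoin x)"
    and "a \<in> carrier (rat_adjoin x)" "b \<in> carrier (rat_adjoin x)" "b \<noteq> 0"
  shows "\<tau> (a / b) = \<tau> a / \<tau> b"
proof -
  have inv: "inverse b \<in> carrier (rat_adjoin x)"
    using assms by (intro rat_adjoin_inverse)
  have "\<tau> b * \<tau> (inverse b) = 1"
    using ring_hom_mult[OF \<tau> assms(3) inv] ring_hom_one[OF \<tau>] assms(4) by simp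
  then have "\<tau> (inverse b) = inverse (\<tau> b)"
    by (rule inverse_unique[symmetric])
  then show ?thesis
    using ring_hom_mult[OF \<tau> assms(2) inv] by (simp add: divide_inverse)
qed

lemma ring_hom_rat_adjoin_frac:
  assumes "\<tau> \<in> ring_hom (rat_adjoin x) (rat_adjoin x)" "ipoly h x \<noteq> 0"
  shows "\<tau> (ipoly f x / ipoly h x) = ipoly f (\<tau> x) / ipoly h (\<tau> x)"
  using assms
  by (simp add: ring_hom_rat_adjoin_divide ring_hom_rat_adjoin_ipoly rat_adjoin_ipoly rat_adjoin_base)

text \<open>A homomorphism acts on a fraction in the generator by substituting the image of the
  generator.\<close>

lemma ring_hom_rat_adjoin_eqI:
  assumes "\<tau> \<in> ring_hom (rat_adjoin x) (rat_adjoin x)" "\<tau>' \<in> ring_hom (rat_adjoin x) (rat_adjoin x)"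
    and "\<tau> x = \<tau>' x" "y \<in> carrier (rat_adjoin x)"
  shows "\<tau> y = \<tau>' y"
proof -
  obtain f h where "y = ipoly f x / ipoly h x" "ipoly h x \<noteq> 0"
    using assms(4) by (auto simp: carrier_rat_adjoin)
  then show ?thesis
    using assms(3) by (simp add: ring_hom_rat_adjoin_frac[OF assms(1)] ring_hom_rat_adjoin_frac[OF assms(2)])
qed

lemma ring_hom_rat_adjoin_Rats:
  assumes "\<tau> \<in> ring_hom (rat_adjoin x) (rat_adjoin x)" "q \<in> \<rat>"
  shows "\<tau> q = q"
proof -
  from assms(2) obtain a b where "b > 0" "q = of_int a / of_int b"
    by (rule Rats_cases') auto
  then have "q = ipoly [:a:] x / ipoly [:b:] x" "ipoly [:b:] x \<noteq> 0" "q = ipoly [:a:] (\<tau> x) / ipoly [:b:] (\<tau> x)"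
    by simp_all
  then show ?thesis
    using ring_hom_rat_adjoin_frac[OF assms(1)] by metis
qed

text \<open>Substitution of \<open>x'\<close> for \<open>x\<close> in fractions. The choice is
  unambiguous once \<open>x\<close> and \<open>x'\<close> are zeros of the same integer polynomials;
  the restriction makes the map extensional, as \<open>Bij\<close> demands.\<close>

definition conj_map :: "real \<Rightarrow> real \<Rightarrow> real \<Rightarrow> real" where
  "conj_map x x' = (\<lambda>y\<in>carrier (rat_adjoin x).
     SOME v. \<exists>f h. ipoly h x \<noteq> 0 \<and> y = ipoly f x / ipoly h x \<and> v = ipoly f x' / ipoly h x')"

text \<open>Two fractions agree at \<open>x\<close> iff a cross-multiplied polynomial vanishes
  there, and this carries over to \<open>x'\<close>.\<close>

lemma conj_map_frac:
  assumes "\<And>f. ipoly f x = 0 \<longleftrightarrow> ipoly f x' = 0" "ipoly h x \<noteq> 0"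
  shows "conj_map x x' (ipoly f x / ipoly h x) = ipoly f x' / ipoly h x'"
proof -
  have eq: "ipoly g x' / ipoly k x' = ipoly f x' / ipoly h x'"
    if "ipoly k x \<noteq> 0" "ipoly f x / ipoly h x = ipoly g x / ipoly k x" for g k
  proof -
    have "ipoly (f * k - g * h) x = 0"
      using that assms(2) by (simp add: frac_eq_eq)
    then have "ipoly (f * k - g * h) x' = 0"
      using assms(1) by blast
    moreover have "ipoly k x' \<noteq> 0" "ipoly h x' \<noteq> 0"
      using assms that by auto
    ultimately show ?thesis
      by (simp add: frac_eq_eq)
  qed
  have mem: "ipoly f x / ipoly h x \<in> carrier (rat_adjoin x)"
    using assms(2) by (auto simp: carrier_rat_adjoin)
  show ?thesis
    unfolding conj_map_def restrict_apply'[OF mem]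
    by (rule some_equality) (use assms(2) eq in blast)+
qed

lemma conj_map_base:
  assumes "\<And>f. ipoly f x = 0 \<longleftrightarrow> ipoly f x' = 0"
  shows "conj_map x x' x = x'"
  using conj_map_frac[OF assms, of 1 "[:0, 1:]"] by simp

lemma conj_map_ring_hom:
  assumes conj: "\<And>f. ipoly f x = 0 \<longleftrightarrow> ipoly f x' = 0" and x': "x' \<in> carrier (rat_adjoin x)"
  shows "conj_map x x' \<in> ring_hom (rat_adjoin x) (rat_adjoin x)"
proof (rule ring_hom_memI, simp_all)
  note frac = conj_map_frac[OF conj]
  show "conj_map x x' y \<in> carrier (rat_adjoin x)" if y: "y \<in> carrier (rat_adjoin x)" for y
  proof -
    obtain f h where "y = ipoly f x / ipoly h x" "ipoly h x \<noteq> 0"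
      using y unfolding carrier_rat_adjoin by blast
    then show ?thesis
      using x' by (simp add: frac divide_inverse[of "ipoly f x'"] rat_adjoin_mult rat_adjoin_inverse rat_adjoin_ipoly)
  qed
  show "conj_map x x' 1 = 1"
    using frac[of 1 1] by simp
  fix y z assume "y \<in> carrier (rat_adjoin x)" "z \<in> carrier (rat_adjoin x)"
  then obtain f h g k where y: "y = ipoly f x / ipoly h x" "ipoly h x \<noteq> 0"
    and z: "z = ipoly g x / ipoly k x" "ipoly k x \<noteq> 0"
    unfolding carrier_rat_adjoin by blast
  have nz: "ipoly h x' \<noteq> 0" "ipoly k x' \<noteq> 0"
    using y z conj by auto
  have nz': "ipoly (h * k) x \<noteq> 0"
    using y z by simp
  have sum: "y + z = ipoly (f * k + g * h) x / ipoly (h * k) x"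
    using y z by (simp add: add_frac_eq)
  have "conj_map x x' (y + z) = ipoly (f * k + g * h) x' / ipoly (h * k) x'"
    unfolding sum using nz' by (rule frac)
  then show "conj_map x x' (y + z) = conj_map x x' y + conj_map x x' z"
    using y z nz by (simp add: frac add_frac_eq)
  have prod: "y * z = ipoly (f * g) x / ipoly (h * k) x"
    using y z by simp
  have "conj_map x x' (y * z) = ipoly (f * g) x' / ipoly (h * k) x'"
    unfolding prod using nz' by (rule frac)
  then show "conj_map x x' (y * z) = conj_map x x' y * conj_map x x' z"
    using y z by (simp add: frac)
qed

subsection \<open>The Galois group\<close>

text \<open>\<open>ipoly_cos_conjugate\<close> for \<open>N = 2 * n\<close>, with the integer
  indices replaced by their natural residues modulo \<open>N\<close>.\<close>

lemma ipoly_rho_conj_mult: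
  assumes "n > 0" "coprime m (2 * int n)" "ipoly f (rho_conj n j) = 0"
  shows "ipoly f (rho_conj n (j * m)) = 0"
proof -
  define N where "N = 2 * n"
  define a b where "a = nat (j mod int N)" and "b = nat (m mod int N)"
  have N: "N > 0" using assms(1) by (simp add: N_def)
  have a: "int a = j mod int N" and b: "int b = m mod int N"
    using N by (simp_all add: a_def b_def)
  have rho: "rho_conj n (int k) = 2 * cos (2 * pi * real k / real N)" for k
    using assms(1) by (simp add: rho_conj_def N_def)
  have "cong_pm n (int a) j"
    unfolding cong_pm_def a N_def by (simp add: mod_eq_dvd_iff[symmetric])
  then have "rho_conj n (int a) = rho_conj n j"
    by (rule rho_conj_cong[OF assms(1)])
  then have fa: "ipoly f (2 * cos (2 * pi * real a / real N)) = 0"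
    using assms(3) by (simp add: rho)
  have "coprime (int b) (int N)"
    using assms N unfolding b by (subst coprime_mod_left_iff) (simp_all add: N_def)
  then have "coprime b N"
    by simp
  then have "ipoly f (rho_conj n (int (a * b))) = 0"
    using ipoly_cos_conjugate[OF N _ fa] by (simp only: rho)
  moreover have "cong_pm n (int (a * b)) (j * m)"
  proof -
    have "[int a * int b = j * m] (mod int N)"
      unfolding a b by (intro cong_mult) auto
    then show ?thesis
      by (simp add: cong_pm_def cong_iff_dvd_diff N_def)
  qed
  ultimately show ?thesis
    using rho_conj_cong[OF assms(1)] by metis
qed

text \<open>The way back multiplies the index by an inverse of \<open>m\<close> modulo
  \<open>2 * n\<close>.\<close>

lemma ipoly_rho_conj_iff:
  assumes "n > 0" "coprime m (2 * int n)"
  shows "ipoly f (rho n) = 0 \<longleftrightarrow> ipoly f (rho_conj n m) = 0"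
proof
  assume "ipoly f (rho n) = 0"
  then show "ipoly f (rho_conj n m) = 0"
    using ipoly_rho_conj_mult[OF assms, of f 1] by (simp add: rho_conj_1)
next
  assume f: "ipoly f (rho_conj n m) = 0"
  obtain y where y: "coprime y (2 * int n)" "cong_pm n (y * m) 1"
    using coprime_inverse_mod[OF assms(2)] .
  have "ipoly f (rho_conj n (m * y)) = 0"
    using ipoly_rho_conj_mult[OF assms(1) y(1) f] .
  then show "ipoly f (rho n) = 0"
    using rho_conj_cong[OF assms(1) y(2)] by (simp add: rho_conj_1 mult.commute)
qed

section \<open>Automorphisms and their action on the numbers 2 cos(k pi / n)\<close>

lemma rho_conj_minus: "rho_conj n (- k) = rho_conj n k"
  by (simp add: rho_conj_def)

text \<open>Normality of the extension: the Dickson polynomials express the conjugates through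
  \<open>rho n\<close>.\<close>

lemma rho_conj_mem: "rho_conj n k \<in> carrier (rat_adjoin (rho n))"
proof -
  have "rho_conj n k = rho_conj n (int (nat \<bar>k\<bar>))"
    by (cases "k \<ge> 0") (auto simp: rho_conj_minus)
  also have "\<dots> = ipoly (dickson (nat \<bar>k\<bar>)) (rho n)"
    using ipoly_dickson_rho_conj[of _ n 1] by (simp add: rho_conj_1)
  finally show ?thesis
    by (simp add: rat_adjoin_ipoly rat_adjoin_base)
qed

text \<open>Homomorphisms commute with Dickson polynomials, which multiply indices.\<close>

lemma ring_hom_rho_conj:
  assumes "\<tau> \<in> ring_hom (rat_adjoin (rho n)) (rat_adjoin (rho n))" "\<tau> (rho n) = rho_conj n m"
  shows "\<tau> (rho_conj n k) = rho_conj n (k * m)"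
proof -
  have *: "\<tau> (rho_conj n (int j)) = rho_conj n (int j * m)" for j
    using ring_hom_rat_adjoin_ipoly[OF assms(1) rat_adjoin_base, of "dickson j"]
      ipoly_dickson_rho_conj[of j n 1] ipoly_dickson_rho_conj[of j n m] assms(2)
    by (simp add: rho_conj_1)
  show ?thesis
  proof (cases k)
    case (nonneg j)
    then show ?thesis using * by simp
  next
    case (neg j)
    then show ?thesis
      by (simp only: neg rho_conj_minus mult_minus_left *)
  qed
qed

text \<open>The Dickson relation for \<open>2 * n\<close> gives an index \<open>k\<close>. If
  \<open>d\<close> is the gcd of \<open>k\<close> and \<open>2 * n = d * e\<close>, then
  \<open>rho_conj n e\<close> and 2 have the same image, so injectivity makes \<open>e\<close> a
  multiple of \<open>2 * n\<close>, forcing \<open>d = 1\<close>.\<close>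

lemma ring_iso_rho_image:
  assumes "n \<ge> 2" and \<tau>: "\<tau> \<in> ring_iso (rat_adjoin (rho n)) (rat_adjoin (rho n))"
  obtains m where "m \<in> modd_units n" "\<tau> (rho n) = rho_conj n m"
proof -
  have hom: "\<tau> \<in> ring_hom (rat_adjoin (rho n)) (rat_adjoin (rho n))"
    and inj: "inj_on \<tau> (carrier (rat_adjoin (rho n)))"
    using \<tau> by (auto simp: ring_iso_def bij_betw_def)
  have n: "n > 0"
    using assms(1) by simp
  have per: "rho_conj n (2 * int n) = 2"
    using n by (simp add: rho_conj_def)
  have rho: "ipoly (dickson j) (rho n) = rho_conj n (int j)" for j
    using ipoly_dickson_rho_conj[of j n 1] by (simp add: rho_conj_1)
  have ip: "\<tau> (ipoly f (rho n)) = ipoly f (\<tau> (rho n))" for f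
    by (rule ring_hom_rat_adjoin_ipoly[OF hom rat_adjoin_base])
  have two: "\<tau> 2 = 2"
    using ip[of "[:2:]"] by simp
  have "ipoly (dickson (2 * n)) (\<tau> (rho n)) = 2"
    unfolding ip[symmetric] rho using per two by simp
  then obtain k :: nat where "\<tau> (rho n) = 2 * cos (2 * pi * real k / real (2 * n))"
    using n by (elim dickson_eq_2_imp_cos[rotated]) auto
  then have k: "\<tau> (rho n) = rho_conj n (int k)"
    using n by (simp add: rho_conj_def)
  have "coprime k (2 * n)"
  proof -
    define d where "d = gcd k (2 * n)"
    have d: "d > 0"
      using n by (simp add: d_def)
    obtain e where e: "2 * n = d * e"
      unfolding d_def by (metis dvdE gcd_dvd2)
    obtain k' where k': "k = d * k'"
      unfolding d_def by (metis dvdE gcd_dvd1)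
    have "e * k = 2 * n * k'"
      unfolding e k' by (simp add: mult_ac)
    then have ek: "int e * int k = 2 * int n * int k'"
      by (metis of_nat_mult of_nat_numeral)
    have "\<tau> (rho_conj n (int e)) = rho_conj n (int e * int k)"
      by (rule ring_hom_rho_conj[OF hom k])
    also note ek
    also have "rho_conj n (2 * int n * int k') = rho_conj n 0"
      by (rule rho_conj_cong[OF n]) (simp add: cong_pm_def)
    also have "\<dots> = \<tau> 2"
      by (simp add: rho_conj_def two)
    finally have "rho_conj n (int e) = 2"
      using inj_onD[OF inj] rho_conj_mem rat_adjoin_of_int[of 2] by simp
    then have "cos (pi * real e / real n) = 1"
      by (simp add: rho_conj_def)
    then obtain c :: int where "pi * real e / real n = of_int c * 2 * pi"
      unfolding cos_one_2pi_int by blast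
    then have "real e = of_int c * real (2 * n)"
      using n by (simp add: field_simps)
    then have "int e = c * int (2 * n)"
      by (metis of_int_eq_iff of_int_mult of_int_of_nat_eq)
    then have "int e * 1 = int e * (c * int d)"
      unfolding e by simp
    then have "c * int d = 1"
      using e n by (metis mult_cancel_left mult_0_right mult_pos_pos neq0_conv of_nat_eq_0_iff zero_less_numeral)
    then have "int d dvd 1"
      by (metis dvd_triv_right)
    then have "d = 1"
      by simp
    then show ?thesis
      by (simp add: d_def coprime_iff_gcd_eq_1)
  qed
  then have "coprime (int k) (2 * int n)"
    by (metis coprime_int_iff of_nat_mult of_nat_numeral)
  \<comment> \<open>The index \<open>k\<close> may exceed \<open>n\<close>; its representative gives
    the same cosine.\<close>
  note m = modd_mem_units[OF assms(1) this]
  show ?thesis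
    using that[OF m(1)] k rho_conj_cong[OF n m(2)] by simp
qed

text \<open>The angles lie in the interval from 0 to \<open>pi\<close>, where cosine is
  injective.\<close>

lemma rho_conj_inj:
  assumes "a \<in> modd_units n" "b \<in> modd_units n" "rho_conj n a = rho_conj n b"
  shows "a = b"
proof -
  have *: "0 \<le> pi * real_of_int c / real n" "pi * real_of_int c / real n \<le> pi" if "c \<in> modd_units n" for c
    using that by (auto simp: modd_units_def field_simps)
  have "pi * real_of_int a / real n = pi * real_of_int b / real n"
    using cos_inj_pi[OF *[OF assms(1)] *[OF assms(2)]] assms(3) by (simp add: rho_conj_def)
  then show ?thesis
    using assms(1) by (auto simp: modd_units_def)
qed

text \<open>All comparisons of maps are made at the generator: \<open>\<phi> m\<close> is the
  automorphism that sends \<open>rho n\<close> to \<open>rho_conj n m\<close>.\<close>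

lemma modd_monoid_iso_galois_group:
  assumes "n \<ge> 2"
  shows "modd_monoid n \<cong> galois_group (rat_adjoin (rho n)) \<rat>"
proof -
  let ?L = "rat_adjoin (rho n)"
  define \<phi> where "\<phi> m = conj_map (rho n) (rho_conj n m)" for m
  have n: "n > 0"
    using assms by simp
  have unit: "coprime m (2 * int n)" if "m \<in> modd_units n" for m
    using that by (simp add: mem_modd_units_iff)
  have hom: "\<phi> m \<in> ring_hom ?L ?L" and base: "\<phi> m (rho n) = rho_conj n m" if "m \<in> modd_units n" for m
    using ipoly_rho_conj_iff[OF n unit[OF that]] rho_conj_mem
    by (auto simp: \<phi>_def intro!: conj_map_ring_hom conj_map_base)
  have ext: "\<phi> m \<in> extensional (carrier ?L)" for m
    by (simp add: \<phi>_def conj_map_def)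
  have closed: "\<phi> m y \<in> carrier ?L" if "m \<in> modd_units n" "y \<in> carrier ?L" for m y
    using ring_hom_closed[OF hom] that by blast
  have comp: "\<phi> a (\<phi> b y) = \<phi> (modd n (a * b)) y"
    if "a \<in> modd_units n" "b \<in> modd_units n" "y \<in> carrier ?L" for a b y
  proof -
    have "coprime (a * b) (2 * int n)"
      using that unit by simp
    note ab = modd_mem_units[OF assms this]
    have "(\<phi> a \<circ> \<phi> b) y = \<phi> (modd n (a * b)) y"
    proof (rule ring_hom_rat_adjoin_eqI[OF _ hom[OF ab(1)] _ that(3)])
      show "\<phi> a \<circ> \<phi> b \<in> ring_hom ?L ?L"
        using hom that by (blast intro: ring_hom_trans)
      \<comment> \<open>Composition multiplies the indices in reverse order, which commutativity
        repairs.\<close>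
      have "\<phi> a (\<phi> b (rho n)) = rho_conj n (b * a)"
        using that hom base by (simp add: ring_hom_rho_conj)
      also have "\<dots> = \<phi> (modd n (a * b)) (rho n)"
        using base[OF ab(1)] rho_conj_cong[OF n ab(2)] by (simp add: mult.commute)
      finally show "(\<phi> a \<circ> \<phi> b) (rho n) = \<phi> (modd n (a * b)) (rho n)"
        by simp
    qed
    then show ?thesis
      by simp
  qed
  have one: "1 \<in> modd_units n"
    using assms by (simp add: modd_units_def)
  have id: "\<phi> 1 y = y" if "y \<in> carrier ?L" for y
  proof -
    have "id \<in> ring_hom ?L ?L"
      by (auto intro!: ring_hom_memI)
    from ring_hom_rat_adjoin_eqI[OF hom[OF one] this _ that] show ?thesis
      by (simp add: base[OF one] rho_conj_1)
  qed
  have bij: "bij_betw (\<phi> m) (carrier ?L) (carrier ?L)" if m: "m \<in> modd_units n" for m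
  proof -
    interpret group "modd_monoid n"
      by (rule group_modd_monoid[OF assms])
    \<comment> \<open>The group inverse of \<open>m\<close> supplies the inverse map of
      \<open>\<phi> m\<close>.\<close>
    define m' where "m' = inv\<^bsub>modd_monoid n\<^esub> m"
    have m': "m' \<in> modd_units n" "modd n (m' * m) = 1" "modd n (m * m') = 1"
      using inv_closed[of m] l_inv[of m] r_inv[of m] m by (simp_all add: m'_def modd_monoid_def)
    show ?thesis
      by (rule bij_betw_byWitness[where f' = "\<phi> m'"]) (use comp m m' id closed in auto)
  qed
  have gal: "carrier (galois_group ?L \<rat>) = {\<tau> \<in> Bij (carrier ?L). \<tau> \<in> ring_iso ?L ?L}"
    using ring_hom_rat_adjoin_Rats by (auto simp: galois_group_def ring_iso_def)
  have mem: "\<phi> m \<in> carrier (galois_group ?L \<rat>)" if "m \<in> modd_units n" for m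
    using bij[OF that] hom[OF that] ext by (simp add: gal Bij_def ring_iso_def)
  have "\<phi> \<in> iso (modd_monoid n) (galois_group ?L \<rat>)"
  proof (rule isoI)
    show "\<phi> \<in> hom (modd_monoid n) (galois_group ?L \<rat>)"
    proof (rule homI)
      fix a b assume ab: "a \<in> carrier (modd_monoid n)" "b \<in> carrier (modd_monoid n)"
      then have ab': "a \<in> modd_units n" "b \<in> modd_units n"
        by (simp_all add: modd_monoid_def)
      \<comment> \<open>Both sides are \<open>undefined\<close> off the carrier, so agreement on it
        suffices.\<close>
      have "\<phi> (modd n (a * b)) = compose (carrier ?L) (\<phi> a) (\<phi> b)"
        by (rule extensionalityI[OF ext compose_extensional]) (simp add: comp ab' compose_eq)
      moreover have "\<phi> a \<in> Bij (carrier ?L)" "\<phi> b \<in> Bij (carrier ?L)"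
        using mem ab' by (auto simp: gal)
      ultimately show "\<phi> (a \<otimes>\<^bsub>modd_monoid n\<^esub> b) = \<phi> a \<otimes>\<^bsub>galois_group ?L \<rat>\<^esub> \<phi> b"
        by (simp add: modd_monoid_def galois_group_def BijGroup_def)
    qed (use mem in \<open>simp add: modd_monoid_def\<close>)
    show "bij_betw \<phi> (carrier (modd_monoid n)) (carrier (galois_group ?L \<rat>))"
    proof (rule bij_betw_imageI)
      show "inj_on \<phi> (carrier (modd_monoid n))"
      proof (rule inj_onI)
        fix a b assume "a \<in> carrier (modd_monoid n)" "b \<in> carrier (modd_monoid n)" and eq: "\<phi> a = \<phi> b"
        then have "a \<in> modd_units n" "b \<in> modd_units n"
          by (simp_all add: modd_monoid_def)
        then show "a = b"
          using base[of a] base[of b] eq by (intro rho_conj_inj) auto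
      qed
      show "\<phi> ` carrier (modd_monoid n) = carrier (galois_group ?L \<rat>)"
      proof (intro equalityI subsetI)
        fix \<tau> assume "\<tau> \<in> carrier (galois_group ?L \<rat>)"
        then have \<tau>: "\<tau> \<in> extensional (carrier ?L)" "\<tau> \<in> ring_iso ?L ?L"
          by (auto simp: gal Bij_def)
        obtain m where m: "m \<in> modd_units n" "\<tau> (rho n) = rho_conj n m"
          using ring_iso_rho_image[OF assms \<tau>(2)] by blast
        have "\<tau> \<in> ring_hom ?L ?L"
          using \<tau>(2) by (simp add: ring_iso_def)
        then have "\<tau> y = \<phi> m y" if "y \<in> carrier ?L" for y
          using ring_hom_rat_adjoin_eqI[OF _ hom[OF m(1)] _ that] m base by simp
        then have "\<tau> = \<phi> m"
          by (rule extensionalityI[OF \<tau>(1) ext])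
        then show "\<tau> \<in> \<phi> ` carrier (modd_monoid n)"
          using m by (simp add: modd_monoid_def)
      qed (use mem in \<open>auto simp: modd_monoid_def\<close>)
    qed
  qed
  then show ?thesis
    by (rule is_isoI)
qed

theorem mainTheorem13:
  fixes n :: nat
  assumes "n \<ge> 2"
  shows "group (modd_monoid n) \<and>
         modd_monoid n \<cong> galois_group (rat_adjoin (rho n)) \<rat>"
  using group_modd_monoid[OF assms] modd_monoid_iso_galois_group[OF assms] by blast

end
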